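(* Let $\mathbb{E}$, $\mathcal{K}$, $f$, $\|\cdot\|$, $\beta$, $\alpha_2$, $\mathcal{X}^*$, $f^*$, $\mathbb{E}_s$, $\mathcal{K}_s$, $s$, $s^*_{\mathcal{K}}$ satisfy all of the assumptions listed in the context. Consider the iterates $(\mathbf{x}_t)_{t\ge 1}$ of the algorithm described in the context (Frank-Wolfe with sparse proximal oracle and hard-thresholding), run with the fixed step-size parameter $\eta=\frac{\alpha_2}{4\beta(8s+s^*_{\mathcal{K}})}\in[0,1]$, and with $\gamma_t$ set either via line-search, or to the pre-defined value $\gamma_t=\eta$ for all $t$. Then $$\forall t\ge 1:\quad f(\mathbf{x}_{t+1})-f^*\le \left(f(\mathbf{x}_t)-f^*\right)\left(1-\frac{\alpha_2}{8\beta(8s+s^*_{\mathcal{K}})}\right).$$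
   Context: Setting. $\mathbb{E}$ is a (finite-dimensional) Euclidean vector space with inner product $\langle\cdot,\cdot\rangle$ and Euclidean norm $\|\mathbf{x}\|_2=\sqrt{\langle \mathbf{x},\mathbf{x}\rangle}$. $\mathcal{K}\subset\mathbb{E}$ is (nonempty) convex and compact. $\|\cdot\|$ is some norm on $\mathbb{E}$, with dual norm $\|\cdot\|_*$. The function $f$ is convex over $\mathcal{K}$ and differentiable, with gradient Lipschitz with parameter $\beta>0$ w.r.t. $\|\cdot\|$: $\|\nabla f(\mathbf{x})-\nabla f(\mathbf{y})\|_*\le\beta\|\mathbf{x}-\mathbf{y}\|$ for all $\mathbf{x},\mathbf{y}\in\mathcal{K}$. The problem is $\min_{\mathbf{x}\in\mathcal{K}}f(\mathbf{x})$; $f^*$ denotes its optimal value and $\mathcal{X}^*\subseteq\mathcal{K}$ its set of minimizers. Quadratic growth. There is $\alpha_2>0$ such that for all $\mathbf{x}\in\mathcal{K}$: $\min_{\mathbf{x}^*\in\mathcal{X}^*}\|\mathbf{x}-\mathbf{x}^*\|_2^2\le\frac{2}{\alpha_2}\left(f(\mathbf{x})-f^*\right)$. Structural assumption. There exists a closed subset $\mathbb{E}_s\subset\mathbb{E}$ such that $\mathcal{X}^*\subseteq\mathcal{K}_s:=\mathcal{K}\cap\mathbb{E}_s$, and there exist scalars $s,s^*_{\mathcal{K}}\ge 1$ such that: 1. for all $\mathbf{x},\mathbf{y}\in\mathbb{E}_s$: $\|\mathbf{x}-\mathbf{y}\|\le\sqrt{2s}\,\|\mathbf{x}-\mathbf{y}\|_2$;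 2. for all $\mathbf{x}\in\mathcal{K}$ and $\mathbf{x}^*\in\mathcal{X}^*$: $\|\mathbf{x}-\mathbf{x}^*\|\le\sqrt{s^*_{\mathcal{K}}}\,\|\mathbf{x}-\mathbf{x}^*\|_2$; 3. for all $\mathbf{x}\in\mathcal{K}$: $\arg\min_{\mathbf{y}\in\mathbb{E}_s}\|\mathbf{y}-\mathbf{x}\|=\arg\min_{\mathbf{y}\in\mathbb{E}_s}\|\mathbf{y}-\mathbf{x}\|_2$ (as sets; the argmin need not be a singleton). $\Pi_{\mathbb{E}_s}[\cdot]$ denotes Euclidean projection onto $\mathbb{E}_s$ (any element of the argmin if it is not a singleton). Algorithm (with parameter $\eta$). Let $\mathbf{x}_1\in\mathcal{K}$ be arbitrary. For $t=1,2,\dots$: - $\widehat{\mathbf{x}}_t\gets\Pi_{\mathbb{E}_s}[\mathbf{x}_t]$; - $\mathbf{v}_t\gets$ an element of $\arg\min_{\mathbf{v}\in\mathcal{K}_s}\ \langle\mathbf{v}-\mathbf{x}_t,\nabla f(\mathbf{x}_t)\rangle+2s\beta\eta\|\mathbf{v}-\widehat{\mathbf{x}}_t\|_2^2$; - set $\gamma_t\in[0,1]$ either by line-search, $\gamma_t\in\arg\min_{\gamma\in[0,1]}f((1-\gamma)\mathbf{x}_t+\gamma\mathbf{v}_t)$, or to a pre-defined value; - $\mathbf{x}_{t+1}\gets(1-\gamma_t)\mathbf{x}_t+\gamma_t\mathbf{v}_t$. *)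

theory Defs
  imports "HOL-Analysis.Analysis"
begin

definition is_norm :: "('a::real_vector \<Rightarrow> real) \<Rightarrow> bool" where
  "is_norm N \<longleftrightarrow>
     (\<forall>x. 0 \<le> N x) \<and>
     (\<forall>x. N x = 0 \<longleftrightarrow> x = 0) \<and>
     (\<forall>c x. N (c *\<^sub>R x) = \<bar>c\<bar> * N x) \<and>
     (\<forall>x y. N (x + y) \<le> N x + N y)"

(* On a Euclidean space the supremum is over a nonempty set that is bounded above whenever N is a norm. *)
definition dual_norm :: "('a::euclidean_space \<Rightarrow> real) \<Rightarrow> 'a \<Rightarrow> real" where
  "dual_norm N y = (SUP x\<in>{x. N x \<le> 1}. x \<bullet> y)"

definition argmin_set :: "('a \<Rightarrow> real) \<Rightarrow> 'a set \<Rightarrow> 'a set" where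
  "argmin_set F S = {x. is_arg_min F (\<lambda>y. y \<in> S) x}"

(* The infimum is attained as soon as the set of minimizers is nonempty and closed. *)
definition quadratic_growth :: "('a::euclidean_space \<Rightarrow> real) \<Rightarrow> 'a set \<Rightarrow> real \<Rightarrow> bool" where
  "quadratic_growth f K \<alpha> \<longleftrightarrow>
     (\<forall>x\<in>K. (INF z\<in>argmin_set f K. (norm (x - z))\<^sup>2) \<le> 2 / \<alpha> * (f x - (INF y\<in>K. f y)))"

(* N is the general norm used for smoothness; the Euclidean norm is norm. *)
definition structural_assumption ::
  "('a::euclidean_space \<Rightarrow> real) \<Rightarrow> ('a \<Rightarrow> real) \<Rightarrow> 'a set \<Rightarrow> 'a set \<Rightarrow> real \<Rightarrow> real \<Rightarrow> bool" where
  "structural_assumption N f K Es s sK \<longleftrightarrow>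
     closed Es \<and> argmin_set f K \<subseteq> K \<inter> Es \<and> 1 \<le> s \<and> 1 \<le> sK \<and>
     (\<forall>x\<in>Es. \<forall>y\<in>Es. N (x - y) \<le> sqrt (2 * s) * norm (x - y)) \<and>
     (\<forall>x\<in>K. \<forall>z\<in>argmin_set f K. N (x - z) \<le> sqrt sK * norm (x - z)) \<and>
     (\<forall>x\<in>K. argmin_set (\<lambda>y. N (y - x)) Es = argmin_set (\<lambda>y. norm (y - x)) Es)"

(* A run of the algorithm, for any choice of projections, oracle answers and step sizes in [0,1].
   Indices start at 1; g is the gradient of f. *)
definition fw_run ::
  "('a::euclidean_space \<Rightarrow> 'a) \<Rightarrow> 'a set \<Rightarrow> 'a set \<Rightarrow> real \<Rightarrow> real \<Rightarrow> real \<Rightarrow>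
   (nat \<Rightarrow> 'a) \<Rightarrow> (nat \<Rightarrow> 'a) \<Rightarrow> (nat \<Rightarrow> 'a) \<Rightarrow> (nat \<Rightarrow> real) \<Rightarrow> bool" where
  "fw_run g K Es s \<beta> \<eta> x xh v \<gamma> \<longleftrightarrow>
     x 1 \<in> K \<and>
     (\<forall>t\<ge>1.
        xh t \<in> argmin_set (\<lambda>y. norm (y - x t)) Es \<and>
        v t \<in> argmin_set
          (\<lambda>w. (w - x t) \<bullet> g (x t) + 2 * s * \<beta> * \<eta> * (norm (w - xh t))\<^sup>2) (K \<inter> Es) \<and>
        \<gamma> t \<in> {0..1} \<and>
        x (t + 1) = (1 - \<gamma> t) *\<^sub>R x t + \<gamma> t *\<^sub>R v t)"

definition line_search ::
  "('a::euclidean_space \<Rightarrow> real) \<Rightarrow> (nat \<Rightarrow> 'a) \<Rightarrow> (nat \<Rightarrow> 'a) \<Rightarrow> (nat \<Rightarrow> real) \<Rightarrow> bool" where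
  "line_search f x v \<gamma> \<longleftrightarrow>
     (\<forall>t\<ge>1. \<gamma> t \<in> argmin_set (\<lambda>c. f ((1 - c) *\<^sub>R x t + c *\<^sub>R v t)) {0..1})"

end

theory Submission
  imports Defs
begin

text \<open>
  One step of the method with step size \<open>\<eta>\<close> (line search can only do better) is estimated by
  the descent lemma. There \<open>N (v - x)\<^sup>2 \<le> 2 N (v - xh)\<^sup>2 + 2 N (xh - x)\<^sup>2\<close>, where the first term is
  controlled by \<open>s\<close> since \<open>v\<close> and \<open>xh\<close> are both in \<open>Es\<close>, and the second one by \<open>sK\<close>
  because \<open>xh\<close> is also an \<open>N\<close>-projection, hence no further from \<open>x\<close> than the nearest
  minimizer \<open>z\<close>. Comparing the oracle answer \<open>v\<close> with \<open>z\<close>, which needs no convexity of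
  \<open>K \<inter> Es\<close>, bounds the progress by \<open>(z - x) \<bullet> g x\<close> and a multiple of \<open>(norm (x - z))\<^sup>2\<close>; convexity
  and quadratic growth turn both into multiples of the optimality gap.
\<close>

section \<open>Norms on a Euclidean space and the duality inequality\<close>

lemma is_norm_minus_commute:
  assumes "is_norm N"
  shows "N (x - y) = N (y - x)"
proof -
  have "N (-1 *\<^sub>R (x - y)) = \<bar>-1\<bar> * N (x - y)"
    using assms unfolding is_norm_def by blast
  then show ?thesis
    by simp
qed

text \<open>A norm is convex, hence continuous in finite dimension, so it attains a minimum on the
  compact unit sphere. That minimum is positive and serves as \<open>m\<close>; homogeneity carries
  the bound to all vectors. It makes the unit ball of \<open>N\<close> bounded, so that the supremum
  in \<open>dual_norm\<close> is a genuine one.\<close>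

lemma is_norm_ge_norm:
  fixes N :: "'a::euclidean_space \<Rightarrow> real"
  assumes "is_norm N"
  obtains m where "m > 0" "\<And>x. m * norm x \<le> N x"
proof -
  have nonneg: "0 \<le> N x" and zero: "N x = 0 \<longleftrightarrow> x = 0" and scale: "N (c *\<^sub>R x) = \<bar>c\<bar> * N x"
    and triangle: "N (x + y) \<le> N x + N y" for c x y
    using assms by (auto simp: is_norm_def)
  have "convex_on UNIV N"
  proof (rule convex_onI)
    fix t :: real and x y :: 'a
    assume "0 < t" "t < 1"
    then show "N ((1 - t) *\<^sub>R x + t *\<^sub>R y) \<le> (1 - t) * N x + t * N y"
      using triangle[of "(1 - t) *\<^sub>R x" "t *\<^sub>R y"] by (simp add: scale)
  qed simp
  then have "continuous_on UNIV N"
    by (intro convex_on_continuous) auto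
  then have cont: "continuous_on (sphere 0 1) N"
    by (rule continuous_on_subset) simp
  obtain u :: 'a where u: "u \<in> sphere 0 1" "\<And>y. y \<in> sphere 0 1 \<Longrightarrow> N u \<le> N y"
  proof (rule bexE[OF continuous_attains_inf[OF compact_sphere _ cont]])
    show "sphere (0::'a) 1 \<noteq> {}"
      by simp
  qed (use that in blast)
  have "N u > 0"
    using u(1) nonneg[of u] zero[of u] by (cases "u = 0") auto
  moreover have "N u * norm x \<le> N x" for x
  proof (cases "x = 0")
    case False
    have "N u \<le> N (inverse (norm x) *\<^sub>R x)"
      using False by (intro u(2)) simp
    then show ?thesis
      using False by (simp add: scale field_simps)
  qed (simp add: nonneg)
  ultimately show thesis
    using that by blast
qed

text \<open>After division by \<open>N x\<close>, the vector \<open>x\<close> is one of the points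
  over which the supremum in \<open>dual_norm\<close> runs. The supremum bounds its value there
  because \<open>N z \<le> 1\<close> forces \<open>norm z \<le> 1 / m\<close>, so that the inner
  products are bounded by Cauchy-Schwarz.\<close>

lemma inner_le_dual_norm:
  fixes N :: "'a::euclidean_space \<Rightarrow> real"
  assumes "is_norm N"
  shows "x \<bullet> y \<le> N x * dual_norm N y"
proof (cases "x = 0")
  case True
  then have "N x = 0"
    using assms by (simp add: is_norm_def)
  then show ?thesis
    using True by simp
next
  case False
  obtain m where m: "m > 0" "\<And>z. m * norm z \<le> N z"
    using is_norm_ge_norm[OF assms] by blast
  have bdd: "bdd_above ((\<lambda>z. z \<bullet> y) ` {z. N z \<le> 1})"
  proof (rule bdd_aboveI2)
    fix z assume "z \<in> {z. N z \<le> 1}"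
    then have "norm z \<le> 1 / m"
      using m(1) m(2)[of z] by (simp add: field_simps)
    then show "z \<bullet> y \<le> 1 / m * norm y"
      using norm_cauchy_schwarz[of z y] mult_right_mono[of "norm z" "1 / m" "norm y"] by simp
  qed
  have pos: "N x > 0"
    using assms False unfolding is_norm_def by (metis less_eq_real_def)
  then have "N (inverse (N x) *\<^sub>R x) \<le> 1"
    using assms unfolding is_norm_def
    by (metis abs_of_pos inverse_positive_iff_positive left_inverse less_irrefl order_refl)
  then have "(inverse (N x) *\<^sub>R x) \<bullet> y \<le> dual_norm N y"
    unfolding dual_norm_def by (intro cSUP_upper[OF _ bdd]) simp
  then show ?thesis
    using pos by (simp add: field_simps)
qed

section \<open>Gradients, convexity and smoothness along segments\<close>

lemma DERIV_along_segment:
  fixes f :: "'a::real_inner \<Rightarrow> real"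
  assumes "GDERIV f (x + t *\<^sub>R d) :> D"
  shows "((\<lambda>t. f (x + t *\<^sub>R d)) has_real_derivative d \<bullet> D) (at t)"
proof -
  have "((\<lambda>t. x + t *\<^sub>R d) has_derivative (\<lambda>h. h *\<^sub>R d)) (at t)"
    by (auto intro!: derivative_eq_intros)
  from has_derivative_compose[OF this assms[unfolded gderiv_def]]
  show ?thesis
    by (simp add: has_field_derivative_def mult_commute_abs)
qed

text \<open>Convexity bounds every difference quotient along the segment by
  \<open>f y - f x\<close>, and the quotients tend to the directional derivative. The limit is taken
  from the right, since convexity is known only for points between \<open>x\<close> and
  \<open>y\<close>.\<close>

lemma convex_on_ge_tangent:
  fixes f :: "'a::real_inner \<Rightarrow> real"
  assumes "convex_on K f" "x \<in> K" "y \<in> K" "GDERIV f x :> D"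
  shows "(y - x) \<bullet> D \<le> f y - f x"
proof -
  have "((\<lambda>t. f (x + t *\<^sub>R (y - x))) has_real_derivative (y - x) \<bullet> D) (at 0)"
    using assms(4) by (intro DERIV_along_segment) simp
  then have "((\<lambda>t. (f (x + t *\<^sub>R (y - x)) - f x) / t) \<longlongrightarrow> (y - x) \<bullet> D) (at_right 0)"
    unfolding DERIV_def by (auto intro: tendsto_within_subset)
  moreover have "eventually (\<lambda>t. (f (x + t *\<^sub>R (y - x)) - f x) / t \<le> f y - f x) (at_right 0)"
    using eventually_at_right_less[of "0::real"] eventually_at_right_real[OF zero_less_one]
  proof eventually_elim
    case (elim t)
    then have "f ((1 - t) *\<^sub>R x + t *\<^sub>R y) \<le> (1 - t) * f x + t * f y"
      using assms by (intro convex_onD) auto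
    moreover have "(1 - t) *\<^sub>R x + t *\<^sub>R y = x + t *\<^sub>R (y - x)"
      by (simp add: algebra_simps)
    ultimately show ?case
      using elim by (simp add: field_simps)
  qed
  ultimately show ?thesis
    by (intro tendsto_upperbound[where F = "at_right 0"]) auto
qed

lemma descent_lemma:
  fixes f :: "'a::euclidean_space \<Rightarrow> real"
  assumes norm: "is_norm N" and "convex K"
    and grad: "\<And>y. y \<in> K \<Longrightarrow> GDERIV f y :> g y"
    and lipschitz: "\<And>y z. y \<in> K \<Longrightarrow> z \<in> K \<Longrightarrow> dual_norm N (g y - g z) \<le> \<beta> * N (y - z)"
    and "x \<in> K" "y \<in> K" "0 \<le> c" "c \<le> 1"
  shows "f (x + c *\<^sub>R (y - x)) \<le> f x + c * ((y - x) \<bullet> g x) + \<beta> / 2 * c\<^sup>2 * (N (y - x))\<^sup>2"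
proof -
  define d where "d = y - x"
  \<comment> \<open>\<open>\<psi>\<close> is \<open>f\<close> on the segment minus the linear and
    quadratic terms of the claimed bound. Showing that it does not increase replaces integration of
    the gradient: its derivative is a gradient difference paired with \<open>d\<close>, minus
    exactly the bound that duality and the Lipschitz condition give.\<close>
  define \<psi> where "\<psi> t = f (x + t *\<^sub>R d) - t * (d \<bullet> g x) - \<beta> / 2 * t\<^sup>2 * (N d)\<^sup>2" for t
  have "\<psi> c \<le> \<psi> 0"
  proof (rule DERIV_nonpos_imp_nonincreasing[OF \<open>0 \<le> c\<close>])
    fix t assume t: "0 \<le> t" "t \<le> c"
    have "(1 - t) *\<^sub>R x + t *\<^sub>R y \<in> K"
      using assms t by (intro convexD) auto
    moreover have "(1 - t) *\<^sub>R x + t *\<^sub>R y = x + t *\<^sub>R d"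
      by (simp add: d_def algebra_simps)
    ultimately have mem: "x + t *\<^sub>R d \<in> K"
      by simp
    have "(\<psi> has_real_derivative d \<bullet> g (x + t *\<^sub>R d) - d \<bullet> g x - \<beta> * t * (N d)\<^sup>2) (at t)"
      unfolding \<psi>_def
      by (auto intro!: derivative_eq_intros DERIV_along_segment grad mem)
    moreover have "d \<bullet> g (x + t *\<^sub>R d) - d \<bullet> g x - \<beta> * t * (N d)\<^sup>2 \<le> 0"
    proof -
      have "d \<bullet> (g (x + t *\<^sub>R d) - g x) \<le> N d * dual_norm N (g (x + t *\<^sub>R d) - g x)"
        by (rule inner_le_dual_norm[OF norm])
      also have "\<dots> \<le> N d * (\<beta> * N (x + t *\<^sub>R d - x))"
        using norm lipschitz[OF mem \<open>x \<in> K\<close>] by (intro mult_left_mono) (auto simp: is_norm_def)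
      also have "\<dots> = \<beta> * t * (N d)\<^sup>2"
        using norm t by (simp add: is_norm_def power2_eq_square)
      finally show ?thesis
        by (simp add: inner_diff_right)
    qed
    ultimately show "\<exists>D. (\<psi> has_real_derivative D) (at t) \<and> D \<le> 0"
      by blast
  qed
  then show ?thesis
    by (simp add: \<psi>_def d_def)
qed

section \<open>Minimizers and quadratic growth\<close>

lemma argmin_set_real_iff:
  fixes F :: "'a \<Rightarrow> real"
  shows "x \<in> argmin_set F S \<longleftrightarrow> x \<in> S \<and> (\<forall>y\<in>S. F x \<le> F y)"
  by (auto simp: argmin_set_def is_arg_min_linorder)

text \<open>This turns the infimum in \<open>quadratic_growth\<close> into a concrete minimizer. The
  minimizers form a nonempty closed set, so one of them is nearest to \<open>x\<close>, and its
  squared distance is a lower bound for all those in the infimum.\<close>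

lemma quadratic_growth_nearest_minimizer:
  fixes f :: "'a::euclidean_space \<Rightarrow> real"
  assumes K: "compact K" "K \<noteq> {}" and cont: "continuous_on K f"
    and growth: "quadratic_growth f K \<alpha>" and x: "x \<in> K"
  obtains z where "z \<in> argmin_set f K" "f z = (INF y\<in>K. f y)"
    "(norm (x - z))\<^sup>2 \<le> 2 / \<alpha> * (f x - f z)"
proof -
  obtain m where m: "m \<in> K" "\<And>y. y \<in> K \<Longrightarrow> f m \<le> f y"
    using continuous_attains_inf[OF K cont] by blast
  \<comment> \<open>As the preimage of a single value under a function continuous on the closed set
    \<open>K\<close>, the set of minimizers is closed.\<close>
  have argmin: "argmin_set f K = K \<inter> f -` {f m}"
  proof (intro equalityI subsetI)
    fix y assume "y \<in> argmin_set f K"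
    then show "y \<in> K \<inter> f -` {f m}"
      using m(1) m(2)[of y] by (auto simp: argmin_set_real_iff intro!: order.antisym)
  qed (use m(2) in \<open>auto simp: argmin_set_real_iff\<close>)
  have Inf: "(INF y\<in>K. f y) = f m"
    using m by (intro cInf_eq_minimum) auto
  have "closed (argmin_set f K)"
    unfolding argmin using K cont
    by (subst Int_commute) (intro continuous_on_closed_vimage[THEN iffD1, rule_format]
        compact_imp_closed closed_singleton)
  moreover have nonempty: "argmin_set f K \<noteq> {}"
    using m argmin by auto
  ultimately obtain z where z: "z \<in> argmin_set f K"
      "\<And>y. y \<in> argmin_set f K \<Longrightarrow> dist x z \<le> dist x y"
    using distance_attains_inf by blast
  have "(norm (x - z))\<^sup>2 \<le> (INF y\<in>argmin_set f K. (norm (x - y))\<^sup>2)"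
    using nonempty z(2) by (intro cINF_greatest) (auto simp: dist_norm intro: power_mono)
  also have "\<dots> \<le> 2 / \<alpha> * (f x - (INF y\<in>K. f y))"
    using growth x by (simp add: quadratic_growth_def)
  finally show thesis
    using that[OF z(1)] z(1) argmin Inf by auto
qed

section \<open>Progress in a single step, and the contraction along a run\<close>

lemma sum_squared_le:
  fixes a b c :: real
  assumes "0 \<le> c" "c \<le> a + b"
  shows "c\<^sup>2 \<le> 2 * a\<^sup>2 + 2 * b\<^sup>2"
  using power_mono[OF assms(2,1), of 2] sum_squares_bound[of a b] by (simp add: power2_sum)

lemma sparse_proximal_step:
  fixes f :: "'a::euclidean_space \<Rightarrow> real"
  assumes K: "K \<noteq> {}" "convex K" "compact K" and norm: "is_norm N" and conv: "convex_on K f"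
    and grad: "\<And>y. y \<in> K \<Longrightarrow> GDERIV f y :> g y"
    and "\<beta> > 0"
    and lipschitz: "\<And>y z. y \<in> K \<Longrightarrow> z \<in> K \<Longrightarrow> dual_norm N (g y - g z) \<le> \<beta> * N (y - z)"
    and "\<alpha> > 0" and growth: "quadratic_growth f K \<alpha>"
    and struct: "structural_assumption N f K Es s sK"
    and \<eta>: "\<eta> = \<alpha> / (4 * \<beta> * (8 * s + sK))" "\<eta> \<le> 1"
    and x: "x \<in> K"
    and xh: "xh \<in> argmin_set (\<lambda>y. norm (y - x)) Es"
    and v: "v \<in> argmin_set (\<lambda>w. (w - x) \<bullet> g x + 2 * s * \<beta> * \<eta> * (norm (w - xh))\<^sup>2) (K \<inter> Es)"
  shows "f (x + \<eta> *\<^sub>R (v - x)) - (INF y\<in>K. f y) \<le> (f x - (INF y\<in>K. f y)) * (1 - \<eta> / 2)"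
proof -
  have s: "1 \<le> s" "1 \<le> sK"
    and minimizers: "argmin_set f K \<subseteq> K \<inter> Es"
    and N_Es: "\<And>y z. y \<in> Es \<Longrightarrow> z \<in> Es \<Longrightarrow> N (y - z) \<le> sqrt (2 * s) * norm (y - z)"
    and N_min: "\<And>z. z \<in> argmin_set f K \<Longrightarrow> N (x - z) \<le> sqrt sK * norm (x - z)"
    and proj: "argmin_set (\<lambda>y. N (y - x)) Es = argmin_set (\<lambda>y. norm (y - x)) Es"
    using struct x by (auto simp: structural_assumption_def)
  have N_nonneg: "0 \<le> N y" for y
    using norm by (simp add: is_norm_def)
  have "8 * s + sK > 0"
    using s by simp
  then have "\<eta> > 0"
    using \<eta>(1) \<open>\<alpha> > 0\<close> \<open>\<beta> > 0\<close> by simp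
  have "continuous_on K f"
    using grad by (intro has_derivative_continuous_on) (auto simp: gderiv_def intro: has_derivative_at_withinI)
  then obtain z where z: "z \<in> argmin_set f K" "f z = (INF y\<in>K. f y)"
      and dist_z: "(norm (x - z))\<^sup>2 \<le> 2 / \<alpha> * (f x - f z)"
    using quadratic_growth_nearest_minimizer K(3,1) growth x by blast
  define d where "d = norm (x - z)"
  have z_mem: "z \<in> K" "z \<in> Es"
    using z(1) minimizers by auto
  have v_mem: "v \<in> K" "v \<in> Es"
    and v_le: "(v - x) \<bullet> g x + 2 * s * \<beta> * \<eta> * (norm (v - xh))\<^sup>2
      \<le> (z - x) \<bullet> g x + 2 * s * \<beta> * \<eta> * (norm (z - xh))\<^sup>2"
    using v z_mem by (auto simp: argmin_set_real_iff)
  \<comment> \<open>Both bounds compare \<open>xh\<close> with the competitor \<open>z\<close> in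
    \<open>Es\<close>. The Euclidean one controls the proximal term at \<open>z\<close>, the one in
    \<open>N\<close> the error of moving from \<open>x\<close> to \<open>xh\<close>.\<close>
  have xh_mem: "xh \<in> Es" and xh_le: "norm (xh - x) \<le> d" "N (xh - x) \<le> N (z - x)"
    using xh xh[folded proj] z_mem by (auto simp: argmin_set_real_iff d_def norm_minus_commute)
  \<comment> \<open>The triangle inequality through \<open>x\<close> gives the factor 2. Its square,
    times the weight \<open>2 * s\<close> of the proximal term, is the source of
    \<open>8 * s\<close> in the rate.\<close>
  have "norm (z - xh) \<le> 2 * d"
    using xh_le(1) norm_triangle_ineq[of "z - x" "x - xh"] by (simp add: d_def norm_minus_commute)
  then have norm_z: "(norm (z - xh))\<^sup>2 \<le> 4 * d\<^sup>2"
    using power_mono[of "norm (z - xh)" "2 * d" 2] by (simp add: power_mult_distrib)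
  have "(N (v - xh))\<^sup>2 \<le> (sqrt (2 * s) * norm (v - xh))\<^sup>2"
    using N_Es v_mem xh_mem N_nonneg by (intro power_mono) auto
  then have N_v: "(N (v - xh))\<^sup>2 \<le> 2 * s * (norm (v - xh))\<^sup>2"
    using s by (simp add: power_mult_distrib)
  have "N (xh - x) \<le> sqrt sK * d"
    using xh_le(2) N_min[OF z(1)] is_norm_minus_commute[OF norm, of x z] by (simp add: d_def)
  then have "(N (xh - x))\<^sup>2 \<le> (sqrt sK * d)\<^sup>2"
    using N_nonneg by (intro power_mono) auto
  then have N_xh: "(N (xh - x))\<^sup>2 \<le> sK * d\<^sup>2"
    using s by (simp add: power_mult_distrib)
  have "N (v - x) \<le> N (v - xh) + N (xh - x)"
    using norm by (metis is_norm_def diff_add_cancel add_diff_eq)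
  then have "(N (v - x))\<^sup>2 \<le> 2 * (N (v - xh))\<^sup>2 + 2 * (N (xh - x))\<^sup>2"
    by (rule sum_squared_le[OF N_nonneg])
  then have N_step: "(N (v - x))\<^sup>2 \<le> 4 * s * (norm (v - xh))\<^sup>2 + 2 * sK * d\<^sup>2"
    using N_v N_xh by linarith
  have "f (x + \<eta> *\<^sub>R (v - x)) \<le> f x + \<eta> * ((v - x) \<bullet> g x) + \<beta> / 2 * \<eta>\<^sup>2 * (N (v - x))\<^sup>2"
    using \<open>\<eta> > 0\<close> \<eta>(2) x v_mem by (intro descent_lemma[OF norm K(2) grad lipschitz]) auto
  also have "\<dots> \<le> f x + \<eta> * ((v - x) \<bullet> g x)
      + \<beta> / 2 * \<eta>\<^sup>2 * (4 * s * (norm (v - xh))\<^sup>2 + 2 * sK * d\<^sup>2)"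
    using N_step \<open>\<beta> > 0\<close> by (intro add_left_mono mult_left_mono) auto
  \<comment> \<open>The weight in the oracle is chosen for this regrouping:
    \<open>\<beta> / 2 * \<eta>\<^sup>2 * (4 * s)\<close> equals
    \<open>\<eta> * (2 * s * \<beta> * \<eta>)\<close>, so the bracket is precisely the oracle
    objective at \<open>v\<close>, and its minimality lets \<open>z\<close> replace \<open>v\<close>
    next.\<close>
  also have "\<dots> = f x + \<eta> * ((v - x) \<bullet> g x + 2 * s * \<beta> * \<eta> * (norm (v - xh))\<^sup>2)
      + \<beta> * \<eta>\<^sup>2 * sK * d\<^sup>2"
    by (simp add: algebra_simps power2_eq_square)
  also have "\<dots> \<le> f x + \<eta> * ((z - x) \<bullet> g x + 2 * s * \<beta> * \<eta> * (norm (z - xh))\<^sup>2)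
      + \<beta> * \<eta>\<^sup>2 * sK * d\<^sup>2"
    using v_le \<open>\<eta> > 0\<close> by (intro add_left_mono add_right_mono mult_left_mono) auto
  also have "\<dots> \<le> f x + \<eta> * ((f z - f x) + 2 * s * \<beta> * \<eta> * (4 * d\<^sup>2)) + \<beta> * \<eta>\<^sup>2 * sK * d\<^sup>2"
    using convex_on_ge_tangent[OF conv x z_mem(1) grad[OF x]] norm_z \<open>\<eta> > 0\<close> \<open>\<beta> > 0\<close> s
    by (intro add_left_mono add_right_mono mult_left_mono add_mono) auto
  also have "\<dots> = f x - \<eta> * (f x - f z) + \<eta> * (\<eta> * \<beta> * (8 * s + sK)) * d\<^sup>2"
    by (simp add: algebra_simps power2_eq_square)
  \<comment> \<open>The choice of \<open>\<eta>\<close> makes the quadratic error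
    \<open>\<eta> * (\<alpha> / 4) * d\<^sup>2\<close>. Quadratic growth bounds it by
    \<open>\<eta> / 2\<close> times the gap, which is half of the linear decrease, so the other half
    survives.\<close>
  also have "\<eta> * \<beta> * (8 * s + sK) = \<alpha> / 4"
    using \<open>\<beta> > 0\<close> \<open>8 * s + sK > 0\<close> unfolding \<eta>(1) by (simp add: divide_simps)
  also have "f x - \<eta> * (f x - f z) + \<eta> * (\<alpha> / 4) * d\<^sup>2
      \<le> f x - \<eta> * (f x - f z) + \<eta> * (\<alpha> / 4) * (2 / \<alpha> * (f x - f z))"
    using dist_z \<open>\<eta> > 0\<close> \<open>\<alpha> > 0\<close> unfolding d_def by (intro add_left_mono mult_left_mono) auto
  also have "\<dots> = f x - \<eta> / 2 * (f x - f z)"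
    using \<open>\<alpha> > 0\<close> by (simp add: field_simps)
  finally show ?thesis
    unfolding z(2)[symmetric] by (simp add: algebra_simps)
qed

theorem theorem1:
  fixes K Es :: "'a::euclidean_space set"
    and N :: "'a \<Rightarrow> real" and f :: "'a \<Rightarrow> real" and g :: "'a \<Rightarrow> 'a"
    and \<alpha>2 \<beta> s sK \<eta> fstar :: real
    and x xh v :: "nat \<Rightarrow> 'a" and \<gamma> :: "nat \<Rightarrow> real"
  assumes "K \<noteq> {}" and "convex K" and "compact K"
    and "is_norm N"
    and "convex_on K f"
    and "\<forall>y\<in>K. GDERIV f y :> g y"
    and "\<beta> > 0"
    and "\<forall>y\<in>K. \<forall>z\<in>K. dual_norm N (g y - g z) \<le> \<beta> * N (y - z)"
    and "\<alpha>2 > 0" and "quadratic_growth f K \<alpha>2"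
    and "structural_assumption N f K Es s sK"
    and "fstar = (INF y\<in>K. f y)"
    and "\<eta> = \<alpha>2 / (4 * \<beta> * (8 * s + sK))" and "\<eta> \<in> {0..1}"
    and "fw_run g K Es s \<beta> \<eta> x xh v \<gamma>"
    and "line_search f x v \<gamma> \<or> (\<forall>t\<ge>1. \<gamma> t = \<eta>)"
  shows "\<forall>t\<ge>1. f (x (t + 1)) - fstar
           \<le> (f (x t) - fstar) * (1 - \<alpha>2 / (8 * \<beta> * (8 * s + sK)))"
proof -
  note run = assms(15)[unfolded fw_run_def]
  have iter: "x (t + 1) = x t + \<gamma> t *\<^sub>R (v t - x t)" if "t \<ge> 1" for t
    using run that by (simp add: algebra_simps)
  have mem: "x t \<in> K" if "t \<ge> 1" for t
    using that
  proof (induction t rule: dec_induct)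
    case base
    then show ?case
      using run by simp
  next
    case (step t)
    moreover have "v t \<in> K" "\<gamma> t \<in> {0..1}"
      and "x (Suc t) = (1 - \<gamma> t) *\<^sub>R x t + \<gamma> t *\<^sub>R v t"
      using run step.hyps by (auto simp: argmin_set_real_iff)
    ultimately show ?case
      using \<open>convex K\<close> by (auto intro!: convexD)
  qed
  show ?thesis
  proof (intro allI impI)
    fix t :: nat assume t: "t \<ge> 1"
    have "f (x t + \<eta> *\<^sub>R (v t - x t)) - fstar \<le> (f (x t) - fstar) * (1 - \<eta> / 2)"
      unfolding \<open>fstar = _\<close> using assms(6,8,14) run t
      by (intro sparse_proximal_step[OF assms(1-5) _ assms(7) _ assms(9-11,13) _ mem[OF t],
            where g = g and xh = "xh t"]) auto
    moreover have "f (x (t + 1)) \<le> f (x t + \<eta> *\<^sub>R (v t - x t))"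
      using assms(16)
    proof
      \<comment> \<open>Since \<open>\<eta>\<close> lies in the unit interval, it is an admissible
        competitor in the line search.\<close>
      assume "line_search f x v \<gamma>"
      then have "f ((1 - \<gamma> t) *\<^sub>R x t + \<gamma> t *\<^sub>R v t) \<le> f ((1 - \<eta>) *\<^sub>R x t + \<eta> *\<^sub>R v t)"
        using t assms(14) by (simp add: line_search_def argmin_set_real_iff)
      then show ?thesis
        unfolding iter[OF t] by (simp add: algebra_simps)
    qed (use iter[OF t] t in simp)
    moreover have "\<eta> / 2 = \<alpha>2 / (8 * \<beta> * (8 * s + sK))"
      using assms(13) by simp
    ultimately show "f (x (t + 1)) - fstar \<le> (f (x t) - fstar) * (1 - \<alpha>2 / (8 * \<beta> * (8 * s + sK)))"
      by simp
  qed
qed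

end
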